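(* Let $V=(B,\prec)$ be a de Vries algebra with dual filter space $(S_V,\sigma)$. Then $V$ is isomorphic to $(\mathsf{RO}(S_V),\ll)$; that is, there is a Boolean algebra isomorphism $\varphi:B\to\mathsf{RO}(S_V)$ such that $a\prec b$ iff $\varphi(a)\ll\varphi(b)$ for all $a,b\in B$.
   Context: The paper's setting is choice-free: the result is intended without use of the Axiom of Choice or the Boolean Prime Ideal Theorem. A de Vries algebra is a pair $V=(B,\prec)$ with $B$ a complete Boolean algebra and $\prec$ a binary relation on $B$ such that: (A1) $1\prec1$; (A2) $a\prec b$ implies $a\le b$; (A3) $a\le b\prec c\le d$ implies $a\prec d$; (A4) $a\prec b$ and $a\prec c$ imply $a\prec b\wedge c$; (A5) $a\prec b$ implies $\neg b\prec\neg a$; (A6) $a\prec c$ implies $a\prec b\prec c$ for some $b$; (A7) $a\ne0$ implies $b\prec a$ for some $b\neq0$. Filters are proper. A filter $F$ on $B$ is concordant if for every $a\in F$ there is $b\in F$ with $b\prec a$. The dual filter space of $V$ is $(S_V,\sigma)$, where $S_V$ is the set of all concordant filters on $V$ and $\sigma$ is the topology generated by the sets $\widehat a=\{F\in S_V\mid a\in F\}$, $a\in B$. For a topological space $X$ and $U\subseteq X$: $\overline U$ is the closure, $U^\bot=X\setminus\overline U$, and $\mathsf{RO}(X)$ is the Boolean algebra (ordered by inclusion) of regular open sets, i.e. sets with $U^{\bot\bot}=U$. The specialization preorder is $x\le y$ iff every open set containing $x$ contains $y$; $\mathord{\downarrow}U=\{x\mid\exists y\in U:x\le y\}$. For $U,W\subseteq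 X$, $U\ll W$ iff $\overline U\subseteq\mathord{\downarrow}W$. *)

theory Defs
  imports "HOL-Analysis.Abstract_Topology"
begin

section \<open>De Vries algebras\<close>

text \<open>
  A complete Boolean algebra is rendered by the sort intersection
  \<open>{boolean_algebra, complete_lattice}\<close>.  The library class
  \<open>complete_boolean_algebra\<close> would be too strong: it includes
  \<open>complete_distrib_lattice\<close>, i.e. complete distributivity, and so covers only the
  powerset algebras.  The one-element Boolean algebra is allowed.
\<close>

locale de_vries_algebra =
  fixes prec :: "'a::{boolean_algebra, complete_lattice} \<Rightarrow> 'a \<Rightarrow> bool"
  assumes prec_top: "prec top top"
    and prec_imp_le: "prec a b \<Longrightarrow> a \<le> b"
    and prec_mono: "a \<le> b \<Longrightarrow> prec b c \<Longrightarrow> c \<le> d \<Longrightarrow> prec a d"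
    and prec_inf: "prec a b \<Longrightarrow> prec a c \<Longrightarrow> prec a (inf b c)"
    and prec_compl: "prec a b \<Longrightarrow> prec (- b) (- a)"
    and prec_interpolate: "prec a c \<Longrightarrow> \<exists>b. prec a b \<and> prec b c"
    and prec_approx: "a \<noteq> bot \<Longrightarrow> \<exists>b. b \<noteq> bot \<and> prec b a"

definition proper_filter :: "'a::boolean_algebra set \<Rightarrow> bool" where
  "proper_filter F \<longleftrightarrow>
     top \<in> F \<and> bot \<notin> F \<and>
     (\<forall>a\<in>F. \<forall>b\<in>F. inf a b \<in> F) \<and>
     (\<forall>a\<in>F. \<forall>b. a \<le> b \<longrightarrow> b \<in> F)"

definition concordant :: "('a \<Rightarrow> 'a \<Rightarrow> bool) \<Rightarrow> 'a set \<Rightarrow> bool" where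
  "concordant prec F \<longleftrightarrow> (\<forall>a\<in>F. \<exists>b\<in>F. prec b a)"

definition concordant_filters :: "('a::boolean_algebra \<Rightarrow> 'a \<Rightarrow> bool) \<Rightarrow> 'a set set" where
  "concordant_filters prec = {F. proper_filter F \<and> concordant prec F}"

definition filter_hat :: "('a::boolean_algebra \<Rightarrow> 'a \<Rightarrow> bool) \<Rightarrow> 'a \<Rightarrow> 'a set set" where
  "filter_hat prec a = {F \<in> concordant_filters prec. a \<in> F}"

definition dual_filter_space :: "('a::boolean_algebra \<Rightarrow> 'a \<Rightarrow> bool) \<Rightarrow> 'a set topology" where
  "dual_filter_space prec = topology_generated_by (range (filter_hat prec))"

lemma topspace_dual_filter_space: "topspace (dual_filter_space prec) = concordant_filters prec"
  by (auto simp: dual_filter_space_def filter_hat_def concordant_filters_def proper_filter_def)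


section \<open>Regular open sets of a topological space\<close>

definition top_perp :: "'p topology \<Rightarrow> 'p set \<Rightarrow> 'p set" where
  "top_perp X U = topspace X - X closure_of U"

definition RO :: "'p topology \<Rightarrow> 'p set set" where
  "RO X = {U. U \<subseteq> topspace X \<and> top_perp X (top_perp X U) = U}"

definition RO_sup :: "'p topology \<Rightarrow> 'p set \<Rightarrow> 'p set \<Rightarrow> 'p set" where
  "RO_sup X U W = top_perp X (top_perp X (U \<union> W))"

text \<open>
  Isomorphisms onto the Boolean algebra \<open>RO X\<close>, whose operations are: meet \<open>\<inter>\<close>, join
  \<open>RO_sup X\<close>, complement \<open>top_perp X\<close>, bottom \<open>{}\<close> and top \<open>topspace X\<close>.  The lemmas
  below confirm that these are the Boolean operations determined by inclusion on \<open>RO X\<close>.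
\<close>

definition boolean_iso_RO :: "('a::boolean_algebra \<Rightarrow> 'p set) \<Rightarrow> 'p topology \<Rightarrow> bool" where
  "boolean_iso_RO \<phi> X \<longleftrightarrow>
     bij_betw \<phi> UNIV (RO X) \<and>
     (\<forall>a b. \<phi> (inf a b) = \<phi> a \<inter> \<phi> b) \<and>
     (\<forall>a b. \<phi> (sup a b) = RO_sup X (\<phi> a) (\<phi> b)) \<and>
     (\<forall>a. \<phi> (- a) = top_perp X (\<phi> a)) \<and>
     \<phi> bot = {} \<and>
     \<phi> top = topspace X"

lemma top_perp_subset: "top_perp X U \<subseteq> topspace X"
  by (auto simp: top_perp_def)

lemma top_perp_antimono: "U \<subseteq> W \<Longrightarrow> top_perp X W \<subseteq> top_perp X U"
  unfolding top_perp_def by (intro Diff_mono subset_refl closure_of_mono)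

lemma subset_top_perp_perp:
  assumes "openin X U" shows "U \<subseteq> top_perp X (top_perp X U)"
proof -
  have "U \<inter> X closure_of (top_perp X U) = {}"
    using assms openin_Int_closure_of_eq_empty[OF assms, of "top_perp X U"]
      closure_of_subset[OF openin_subset[OF assms]]
    by (auto simp: top_perp_def)
  then show ?thesis
    using openin_subset[OF assms] by (auto simp: top_perp_def)
qed

lemma openin_top_perp: "openin X (top_perp X U)"
  by (simp add: top_perp_def openin_diff)

lemma openin_RO: "U \<in> RO X \<Longrightarrow> openin X U"
  using openin_top_perp[of X "top_perp X U"] by (simp add: RO_def)

lemma top_perp_in_RO:
  assumes "openin X U" shows "top_perp X U \<in> RO X"
  using subset_top_perp_perp[OF openin_top_perp, of X U]
    top_perp_antimono[OF subset_top_perp_perp[OF assms]] top_perp_subset[of X U]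
  by (auto simp: RO_def)

lemma empty_in_RO: "{} \<in> RO X" and topspace_in_RO: "topspace X \<in> RO X"
  by (simp_all add: RO_def top_perp_def)

lemma RO_greatest_lower_bound:
  assumes "U \<in> RO X" "W \<in> RO X" shows "U \<inter> W \<in> RO X"
proof -
  have op: "openin X (U \<inter> W)"
    using assms openin_RO by blast
  have "top_perp X (top_perp X (U \<inter> W)) \<subseteq> top_perp X (top_perp X Z)" if "U \<inter> W \<subseteq> Z" for Z
    using that by (intro top_perp_antimono)
  from this[of U] this[of W] have "top_perp X (top_perp X (U \<inter> W)) \<subseteq> U \<inter> W"
    using assms by (auto simp: RO_def)
  with subset_top_perp_perp[OF op] have "top_perp X (top_perp X (U \<inter> W)) = U \<inter> W"
    by (rule subset_antisym[rotated])
  then show ?thesis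
    using openin_subset[OF op] by (simp add: RO_def)
qed

lemma RO_sup_least_upper_bound:
  assumes "U \<in> RO X" "W \<in> RO X"
  shows "RO_sup X U W \<in> RO X" "U \<subseteq> RO_sup X U W" "W \<subseteq> RO_sup X U W"
    and "\<And>Z. Z \<in> RO X \<Longrightarrow> U \<subseteq> Z \<Longrightarrow> W \<subseteq> Z \<Longrightarrow> RO_sup X U W \<subseteq> Z"
proof -
  have op: "openin X (U \<union> W)"
    using assms openin_RO by blast
  show "RO_sup X U W \<in> RO X"
    by (simp add: RO_sup_def top_perp_in_RO openin_top_perp)
  show "U \<subseteq> RO_sup X U W" "W \<subseteq> RO_sup X U W"
    using subset_top_perp_perp[OF op] by (auto simp: RO_sup_def)
  fix Z assume Z: "Z \<in> RO X" "U \<subseteq> Z" "W \<subseteq> Z"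
  then have "RO_sup X U W \<subseteq> top_perp X (top_perp X Z)"
    unfolding RO_sup_def by (intro top_perp_antimono) auto
  with Z show "RO_sup X U W \<subseteq> Z"
    by (simp add: RO_def)
qed

lemma RO_complement:
  assumes "U \<in> RO X"
  shows "top_perp X U \<in> RO X" "U \<inter> top_perp X U = {}" "RO_sup X U (top_perp X U) = topspace X"
proof -
  note op = openin_RO[OF assms]
  show "top_perp X U \<in> RO X"
    by (rule top_perp_in_RO[OF op])
  show disj: "U \<inter> top_perp X U = {}"
    using closure_of_subset[OF openin_subset[OF op]] by (auto simp: top_perp_def)
  have "top_perp X (U \<union> top_perp X U) \<subseteq> top_perp X U \<inter> top_perp X (top_perp X U)"
    by (simp add: top_perp_antimono)
  also have "\<dots> = {}"
    using assms disj by (auto simp: RO_def)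
  finally have "top_perp X (U \<union> top_perp X U) = {}"
    by simp
  then show "RO_sup X U (top_perp X U) = topspace X"
    by (simp add: RO_sup_def) (simp add: top_perp_def)
qed

lemma boolean_iso_RO_order:
  assumes "boolean_iso_RO \<phi> X" shows "\<phi> a \<subseteq> \<phi> b \<longleftrightarrow> a \<le> b"
proof -
  have "inj \<phi>" and "\<phi> (inf a b) = \<phi> a \<inter> \<phi> b"
    using assms by (auto simp: boolean_iso_RO_def bij_betw_def)
  then have "\<phi> a \<subseteq> \<phi> b \<longleftrightarrow> inf a b = a"
    by (metis inf.absorb_iff1 inj_eq)
  then show ?thesis
    by (simp add: inf.absorb_iff1)
qed


section \<open>The specialization preorder and the relation \<open>\<lless>\<close>\<close>

definition specialization :: "'p topology \<Rightarrow> 'p \<Rightarrow> 'p \<Rightarrow> bool" where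
  "specialization X x y \<longleftrightarrow>
     x \<in> topspace X \<and> y \<in> topspace X \<and> (\<forall>U. openin X U \<and> x \<in> U \<longrightarrow> y \<in> U)"

definition spec_downset :: "'p topology \<Rightarrow> 'p set \<Rightarrow> 'p set" where
  "spec_downset X U = {x \<in> topspace X. \<exists>y\<in>U. specialization X x y}"

definition well_inside :: "'p topology \<Rightarrow> 'p set \<Rightarrow> 'p set \<Rightarrow> bool" where
  "well_inside X U W \<longleftrightarrow> X closure_of U \<subseteq> spec_downset X W"

end

theory Submission
  imports Defs
begin

text \<open>
  The isomorphism is \<^term>\<open>filter_hat prec\<close>.  The filters \<open>{c. prec a c}\<close> with
  \<open>a \<noteq> bot\<close> supply all the points that are needed, so the argument involves no ultrafilters.
  A point \<open>F\<close> lies in the closure of the basic open set of \<open>a\<close> iff \<open>- a \<notin> F\<close>, and a regular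
  open \<open>U\<close> is the basic open set of the supremum of all \<open>a\<close> whose basic open set lies in \<open>U\<close>.
  Specialization is inclusion of filters.  If \<open>prec a b\<close> and \<open>- a \<notin> F\<close>, then \<open>F\<close> and
  \<open>{c. prec a c}\<close> generate a concordant filter containing \<open>b\<close>; if \<open>\<not> prec a b\<close>, then
  \<open>{c. prec (- b) c}\<close> omits \<open>- a\<close> but has no concordant extension containing \<open>b\<close>.
\<close>

section \<open>Concordant filters and the topology they carry\<close>

lemma concordant_filtersI:
  assumes "top \<in> F" "bot \<notin> F"
    and "\<And>a b. a \<in> F \<Longrightarrow> b \<in> F \<Longrightarrow> inf a b \<in> F"
    and "\<And>a b. a \<in> F \<Longrightarrow> a \<le> b \<Longrightarrow> b \<in> F"
    and "\<And>a. a \<in> F \<Longrightarrow> \<exists>b\<in>F. prec b a"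
  shows "F \<in> concordant_filters prec"
  using assms unfolding concordant_filters_def proper_filter_def concordant_def by blast

lemma
  assumes "F \<in> concordant_filters prec"
  shows concordant_filter_top: "top \<in> F"
    and concordant_filter_bot: "bot \<notin> F"
    and concordant_filter_inf: "a \<in> F \<Longrightarrow> b \<in> F \<Longrightarrow> inf a b \<in> F"
    and concordant_filter_up: "a \<in> F \<Longrightarrow> a \<le> b \<Longrightarrow> b \<in> F"
    and concordant_filter_prec: "a \<in> F \<Longrightarrow> \<exists>b\<in>F. prec b a"
  using assms unfolding concordant_filters_def proper_filter_def concordant_def by blast+

lemma concordant_filter_disjoint:
  assumes "F \<in> concordant_filters prec" "a \<in> F" "b \<in> F"
  shows "inf a b \<noteq> bot"
  using concordant_filter_inf[OF assms] concordant_filter_bot[OF assms(1)] by metis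

lemma filter_hat_inf: "filter_hat prec (inf a b) = filter_hat prec a \<inter> filter_hat prec b"
proof -
  have "inf a b \<in> F \<longleftrightarrow> a \<in> F \<and> b \<in> F" if "F \<in> concordant_filters prec" for F
    using concordant_filter_inf[OF that] concordant_filter_up[OF that _ inf_le1]
      concordant_filter_up[OF that _ inf_le2] by metis
  then show ?thesis
    by (auto simp: filter_hat_def)
qed

lemma filter_hat_bot: "filter_hat prec bot = {}"
  by (auto simp: filter_hat_def dest: concordant_filter_bot)

lemma filter_hat_top: "filter_hat prec top = topspace (dual_filter_space prec)"
  by (auto simp: filter_hat_def topspace_dual_filter_space intro: concordant_filter_top)

lemma openin_filter_hat: "openin (dual_filter_space prec) (filter_hat prec a)"
  unfolding dual_filter_space_def by (simp add: topology_generated_by_Basis)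

text \<open>The generating sets form a base, not merely a subbase: by \<open>filter_hat_inf\<close>
  they are closed under binary intersection, and \<open>top\<close> belongs to every concordant
  filter.\<close>

lemma openin_dual_filter_space_basis:
  assumes "openin (dual_filter_space prec) U" "F \<in> U"
  shows "\<exists>c\<in>F. filter_hat prec c \<subseteq> U"
proof -
  have "generate_topology_on (range (filter_hat prec)) U"
    using assms(1) by (simp add: dual_filter_space_def openin_topology_generated_by_iff)
  moreover have "F \<in> concordant_filters prec"
    using openin_subset[OF assms(1)] assms(2) by (auto simp: topspace_dual_filter_space)
  ultimately show ?thesis
    using assms(2)
  proof (induction arbitrary: F)
    case (Int U W)
    then obtain c d where "c \<in> F" "filter_hat prec c \<subseteq> U" "d \<in> F" "filter_hat prec d \<subseteq> W"
      by blast
    then have "inf c d \<in> F" "filter_hat prec (inf c d) \<subseteq> U \<inter> W"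
      using Int.prems concordant_filter_inf by (auto simp: filter_hat_inf)
    then show ?case by blast
  next
    case (UN K)
    then show ?case by blast
  qed (auto simp: filter_hat_def)
qed

lemma specialization_dual_filter_space:
  "specialization (dual_filter_space prec) F G \<longleftrightarrow>
     F \<in> concordant_filters prec \<and> G \<in> concordant_filters prec \<and> F \<subseteq> G"
proof (intro iffI; (elim conjE)?)
  assume s: "specialization (dual_filter_space prec) F G"
  then have "G \<in> filter_hat prec c" if "c \<in> F" for c
  proof -
    have "F \<in> filter_hat prec c"
      using s that by (simp add: specialization_def topspace_dual_filter_space filter_hat_def)
    with s show ?thesis
      using openin_filter_hat[of prec c] unfolding specialization_def by blast
  qed
  with s show "F \<in> concordant_filters prec \<and> G \<in> concordant_filters prec \<and> F \<subseteq> G"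
    by (auto simp: specialization_def topspace_dual_filter_space filter_hat_def)
next
  assume FG: "F \<in> concordant_filters prec" "G \<in> concordant_filters prec" "F \<subseteq> G"
  have "G \<in> U" if U: "openin (dual_filter_space prec) U" "F \<in> U" for U
    using openin_dual_filter_space_basis[OF U] FG by (auto simp: filter_hat_def)
  with FG show "specialization (dual_filter_space prec) F G"
    by (simp add: specialization_def topspace_dual_filter_space)
qed

lemma top_perp_Un: "top_perp X (U \<union> W) = top_perp X U \<inter> top_perp X W"
  by (auto simp: top_perp_def closure_of_Un)

context de_vries_algebra
begin

section \<open>The Boolean isomorphism onto the regular open sets\<close>

lemma prec_filter_concordant:
  assumes "a \<noteq> bot"
  shows "{c. prec a c} \<in> concordant_filters prec"
proof (rule concordant_filtersI)
  show "top \<in> {c. prec a c}"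
    using prec_mono[OF top_greatest prec_top] by simp
  show "bot \<notin> {c. prec a c}"
    using assms prec_imp_le le_bot by blast
  show "\<exists>d\<in>{c. prec a c}. prec d c" if "c \<in> {c. prec a c}" for c
    using that prec_interpolate by blast
qed (auto intro: prec_inf prec_mono[OF order_refl])

text \<open>Approximation from below yields a nonzero \<open>b\<close> with \<open>prec b a\<close>,
  and the filter of \<open>b\<close> is then an explicit point of the basic open set. This takes the
  place of a prime ideal argument.\<close>

lemma filter_hat_nonempty:
  assumes "a \<noteq> bot"
  shows "filter_hat prec a \<noteq> {}"
proof -
  obtain b where "b \<noteq> bot" "prec b a"
    using prec_approx[OF assms] by blast
  then have "{c. prec b c} \<in> filter_hat prec a"
    by (simp add: filter_hat_def prec_filter_concordant)
  then show ?thesis by blast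
qed

lemma filter_hat_disjoint_iff: "filter_hat prec a \<inter> filter_hat prec b = {} \<longleftrightarrow> a \<le> - b"
proof -
  have "filter_hat prec (inf a b) = {} \<longleftrightarrow> inf a b = bot"
    using filter_hat_nonempty filter_hat_bot by metis
  then show ?thesis
    by (simp only: filter_hat_inf inf_shunt)
qed

lemma inj_filter_hat: "inj (filter_hat prec)"
proof -
  \<comment> \<open>The basic open set of \<open>b\<close> misses that of \<open>- b\<close>; hence
    so does the smaller one of \<open>a\<close>.\<close>
  have "a \<le> b" if "filter_hat prec a \<subseteq> filter_hat prec b" for a b
    using that filter_hat_disjoint_iff[of a "- b"] filter_hat_disjoint_iff[of b "- b"] by auto
  then show ?thesis
    by (intro injI antisym) auto
qed

text \<open>The set \<open>top_perp\<close> of \<open>U\<close> is the largest open set disjoint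
  from \<open>U\<close>. A basic open set misses \<open>U\<close> iff its index lies below
  \<open>- a\<close> for every basic piece of \<open>U\<close> with index \<open>a\<close>, and
  completeness of the algebra combines these bounds into one.\<close>

lemma top_perp_open:
  assumes "openin (dual_filter_space prec) U"
  shows "top_perp (dual_filter_space prec) U
           = filter_hat prec (- Sup {a. filter_hat prec a \<subseteq> U})" (is "_ = filter_hat prec (- ?s)")
proof -
  have disj: "filter_hat prec c \<inter> U = {} \<longleftrightarrow> c \<le> - ?s" for c
  proof
    assume "filter_hat prec c \<inter> U = {}"
    then have "a \<le> - c" if "filter_hat prec a \<subseteq> U" for a
      using that by (subst filter_hat_disjoint_iff[symmetric]) auto
    then have "?s \<le> - c"
      by (auto intro: Sup_least)
    then show "c \<le> - ?s"
      by (simp add: compl_le_swap1)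
  next
    assume c: "c \<le> - ?s"
    have "filter_hat prec c \<inter> filter_hat prec a = {}" if "filter_hat prec a \<subseteq> U" for a
    proof -
      have "a \<le> ?s"
        using that by (auto intro: Sup_upper)
      then show ?thesis
        unfolding filter_hat_disjoint_iff using c by (meson compl_mono order_trans)
    qed
    then show "filter_hat prec c \<inter> U = {}"
      \<comment> \<open>Every point of \<open>U\<close> lies in some basic open subset of
        \<open>U\<close>, so missing all of these means missing \<open>U\<close>.\<close>
      using openin_dual_filter_space_basis[OF assms] by (fastforce simp: filter_hat_def)
  qed
  show ?thesis
  proof (intro set_eqI iffI)
    fix F assume F: "F \<in> top_perp (dual_filter_space prec) U"
    then obtain c where "c \<in> F" "filter_hat prec c \<subseteq> top_perp (dual_filter_space prec) U"
      using openin_dual_filter_space_basis[OF openin_top_perp] by blast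
    moreover have "top_perp (dual_filter_space prec) U \<inter> U = {}"
      using closure_of_subset[OF openin_subset[OF assms]] by (auto simp: top_perp_def)
    ultimately have "c \<le> - ?s"
      using disj by blast
    moreover have "F \<in> concordant_filters prec"
      using F top_perp_subset[of "dual_filter_space prec" U] by (auto simp: topspace_dual_filter_space)
    ultimately show "F \<in> filter_hat prec (- ?s)"
      using \<open>c \<in> F\<close> by (auto simp: filter_hat_def intro: concordant_filter_up)
  next
    fix F assume F: "F \<in> filter_hat prec (- ?s)"
    have "filter_hat prec (- ?s) \<inter> dual_filter_space prec closure_of U = {}"
      using disj[of "- ?s"] by (simp add: openin_Int_closure_of_eq_empty openin_filter_hat)
    with F show "F \<in> top_perp (dual_filter_space prec) U"
      by (auto simp: top_perp_def topspace_dual_filter_space filter_hat_def)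
  qed
qed

text \<open>Inclusion of basic open sets reflects the order, so the supremum in
  \<open>top_perp_open\<close> collapses to \<open>a\<close>.\<close>

lemma top_perp_filter_hat:
  "top_perp (dual_filter_space prec) (filter_hat prec a) = filter_hat prec (- a)"
proof -
  have "b \<le> a" if "filter_hat prec b \<subseteq> filter_hat prec a" for b
    using that filter_hat_disjoint_iff[of b "- a"] filter_hat_disjoint_iff[of a "- a"] by auto
  then have "Sup {b. filter_hat prec b \<subseteq> filter_hat prec a} = a"
    by (intro antisym Sup_least Sup_upper) auto
  then show ?thesis
    using top_perp_open[OF openin_filter_hat] by simp
qed

lemma closure_of_filter_hat:
  "dual_filter_space prec closure_of filter_hat prec a = {F \<in> concordant_filters prec. - a \<notin> F}"
  using top_perp_filter_hat[of a] closure_of_subset_topspace[of "dual_filter_space prec"]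
  unfolding top_perp_def topspace_dual_filter_space filter_hat_def by blast

lemma range_filter_hat: "range (filter_hat prec) = RO (dual_filter_space prec)"
proof (intro antisym subsetI)
  fix U assume "U \<in> range (filter_hat prec)"
  then show "U \<in> RO (dual_filter_space prec)"
    using top_perp_in_RO[OF openin_filter_hat] top_perp_filter_hat by (metis double_compl imageE)
next
  fix U assume U: "U \<in> RO (dual_filter_space prec)"
  then have "U = top_perp (dual_filter_space prec) (top_perp (dual_filter_space prec) U)"
    by (simp add: RO_def)
  \<comment> \<open>The inner \<open>top_perp\<close> is basic by \<open>top_perp_open\<close>; the
    outer one only complements its index.\<close>
  then show "U \<in> range (filter_hat prec)"
    unfolding top_perp_open[OF openin_RO[OF U]] top_perp_filter_hat by blast
qed

text \<open>Joins reduce to meets and complements by De Morgan, through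
  \<open>top_perp_Un\<close>.\<close>

lemma boolean_iso_filter_hat: "boolean_iso_RO (filter_hat prec) (dual_filter_space prec)"
  unfolding boolean_iso_RO_def bij_betw_def RO_sup_def
  by (simp add: inj_filter_hat range_filter_hat filter_hat_bot filter_hat_top
      top_perp_filter_hat top_perp_Un flip: filter_hat_inf)

section \<open>Correspondence between \<open>prec\<close> and \<open>well_inside\<close>\<close>

lemma concordant_filter_extension:
  assumes F: "F \<in> concordant_filters prec" and "- a \<notin> F" and "prec a b"
  obtains G where "G \<in> concordant_filters prec" "F \<subseteq> G" "b \<in> G"
proof
  let ?G = "{c. \<exists>d\<in>F. \<exists>e. prec a e \<and> inf d e \<le> c}"
  have top: "prec a top"
    using prec_mono[OF top_greatest prec_top] by simp
  show "?G \<in> concordant_filters prec"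
  proof (rule concordant_filtersI)
    show "top \<in> ?G"
      using concordant_filter_top[OF F] top by auto
    show "bot \<notin> ?G"
    proof
      assume "bot \<in> ?G"
      then obtain d e where de: "d \<in> F" "prec a e" "inf d e = bot"
        by (auto simp: le_bot)
      \<comment> \<open>Were the generated filter improper, a member \<open>d\<close> of
        \<open>F\<close> would lie below \<open>- e\<close>, hence below \<open>- a\<close>, forcing
        \<open>- a\<close> into \<open>F\<close>.\<close>
      then have "d \<le> - e"
        by (simp add: inf_shunt)
      also have "\<dots> \<le> - a"
        using de(2) by (simp add: prec_imp_le)
      finally show False
        using \<open>- a \<notin> F\<close> concordant_filter_up[OF F de(1)] by blast
    qed
  next
    fix x y assume "x \<in> ?G" "y \<in> ?G"
    then obtain d e d' e' where "d \<in> F" "prec a e" "inf d e \<le> x" "d' \<in> F" "prec a e'" "inf d' e' \<le> y"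
      by blast
    moreover from this have "inf (inf d d') (inf e e') \<le> inf x y"
      using inf_mono[of "inf d e" x "inf d' e'" y] by (simp add: inf_assoc inf_left_commute)
    ultimately show "inf x y \<in> ?G"
      by (auto intro!: bexI[of _ "inf d d'"] exI[of _ "inf e e'"] concordant_filter_inf[OF F] prec_inf)
  next
    fix x y assume "x \<in> ?G" "x \<le> y"
    then show "y \<in> ?G"
      by (blast intro: order_trans)
  next
    fix x assume "x \<in> ?G"
    then obtain d e where "d \<in> F" "prec a e" and x: "inf d e \<le> x"
      by blast
    \<comment> \<open>Both generators are shrunk separately: \<open>d\<close> by concordance of
      \<open>F\<close>, \<open>e\<close> by interpolation. The meet of the smaller ones is still in
      the generated filter.\<close>
    then obtain d' e' where d'e': "d' \<in> F" "prec d' d" "prec a e'" "prec e' e"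
      using concordant_filter_prec[OF F] prec_interpolate by blast
    then have "prec (inf d' e') d" "prec (inf d' e') e"
      by (auto intro: prec_mono[OF inf_le1] prec_mono[OF inf_le2])
    then have "prec (inf d' e') x"
      by (rule prec_mono[OF order_refl prec_inf x])
    with d'e' show "\<exists>y\<in>?G. prec y x"
      by blast
  qed
  show "F \<subseteq> ?G"
    using top by (auto intro: le_infI1)
  show "b \<in> ?G"
    using concordant_filter_top[OF F] \<open>prec a b\<close> by (auto intro: le_infI2)
qed

lemma well_inside_filter_hat_iff:
  "well_inside (dual_filter_space prec) (filter_hat prec a) (filter_hat prec b) \<longleftrightarrow>
     (\<forall>F\<in>concordant_filters prec. - a \<notin> F \<longrightarrow>
       (\<exists>G\<in>concordant_filters prec. F \<subseteq> G \<and> b \<in> G))"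
proof -
  have "spec_downset (dual_filter_space prec) (filter_hat prec b)
          = {F \<in> concordant_filters prec. \<exists>G\<in>concordant_filters prec. F \<subseteq> G \<and> b \<in> G}"
    unfolding spec_downset_def specialization_dual_filter_space topspace_dual_filter_space
      filter_hat_def by blast
  then show ?thesis
    unfolding well_inside_def closure_of_filter_hat by blast
qed

lemma prec_iff_well_inside:
  "prec a b \<longleftrightarrow> well_inside (dual_filter_space prec) (filter_hat prec a) (filter_hat prec b)"
proof
  assume "prec a b"
  then show "well_inside (dual_filter_space prec) (filter_hat prec a) (filter_hat prec b)"
    unfolding well_inside_filter_hat_iff by (metis concordant_filter_extension)
next
  assume well: "well_inside (dual_filter_space prec) (filter_hat prec a) (filter_hat prec b)"
  show "prec a b"
  proof (rule ccontr)
    assume "\<not> prec a b"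
    then have a: "\<not> prec (- b) (- a)"
      using prec_compl by fastforce
    \<comment> \<open>Otherwise \<open>b\<close> is \<open>top\<close>, and
      \<open>prec a top\<close> always holds.\<close>
    have "- b \<noteq> bot"
      using \<open>\<not> prec a b\<close> prec_mono[OF top_greatest prec_top] by (metis compl_bot_eq double_compl order_refl)
    then obtain G where G: "G \<in> concordant_filters prec" "{c. prec (- b) c} \<subseteq> G" "b \<in> G"
      using well a prec_filter_concordant unfolding well_inside_filter_hat_iff by blast
    \<comment> \<open>Concordance shrinks \<open>b\<close> to some \<open>c\<close> in
      \<open>G\<close>; complementing gives \<open>prec (- b) (- c)\<close>, so \<open>G\<close>
      contains both \<open>c\<close> and \<open>- c\<close>.\<close>
    then obtain c where c: "c \<in> G" "prec c b"
      using concordant_filter_prec by blast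
    then have "- c \<in> G"
      using G(2) prec_compl by blast
    then show False
      using concordant_filter_disjoint[OF G(1) c(1), of "- c"] by simp
  qed
qed

end

theorem theorem3p7:
  fixes prec :: "'a::{boolean_algebra, complete_lattice} \<Rightarrow> 'a \<Rightarrow> bool"
  assumes "de_vries_algebra prec"
  shows "\<exists>\<phi> :: 'a \<Rightarrow> 'a set set.
           boolean_iso_RO \<phi> (dual_filter_space prec) \<and>
           (\<forall>a b. prec a b \<longleftrightarrow> well_inside (dual_filter_space prec) (\<phi> a) (\<phi> b))"
  using de_vries_algebra.boolean_iso_filter_hat[OF assms]
    de_vries_algebra.prec_iff_well_inside[OF assms] by blast

end
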